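(* Let $\Gamma=(V,E)$ be a finite vertex-transitive graph (possibly disconnected) and $2\leq n\leq |V|-1$. If $h_{n+1}(\Gamma)>2(n+1)h_n(\Gamma)$, then there exist decompositions $V=V_1\sqcup\cdots\sqcup V_n$ and $V=A_1\sqcup\cdots\sqcup A_n$ into $n$ non-empty sets such that: (a) $(V_1,\dots,V_n)$ is a system of imprimitivity of size $n$ for the action $\mathrm{Aut}(\Gamma)\curvearrowright V$; (b) the partition $(A_1,\dots,A_n)$ achieves $h_n(\Gamma)$, i.e. $\max_i |\partial A_i|/|A_i|=h_n(\Gamma)$; (c) for every $1\leq i\leq n$, $|V_i\triangle A_i|\leq \frac{4h_n(\Gamma)}{h_{n+1}(\Gamma)}|V|$. In fact, for any given partition $(A_i)_i$ satisfying (b), there exists $(V_i)_i$ satisfying (a) and (c). In particular, if $G$ is a group acting on $\Gamma$ by graph automorphisms transitively on $V$, and there is no system of imprimitivity of size $n$ for $G\curvearrowright V$, then $h_{n+1}(\Gamma)\leq 2(n+1)h_n(\Gamma)$. The same statements hold with $h_n(\Gamma)$ and $h_{n+1}(\Gamma)$ replaced respectively by $\iota_n(\Gamma)$ and $\iota_{n+1}(\Gamma)$ throughout (including in (b) and (c), where $\partial$ is replaced by $\delta$).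
   Context: All graphs are finite, undirected, regular, without multiple edges or self-loops. For disjoint $A,B\subseteq V$, $\partial(A,B)$ is the set of edges joining $A$ and $B$, $\partial A=\partial(A,V\setminus A)$; $\delta(A,B)$ is the set of vertices of $A$ incident to an edge of $\partial(A,B)$ together with the vertices of $B$ incident to an edge of $\partial(A,B)$, $\delta A=\delta(A,V\setminus A)$. For $2\le n\le|V|$, $h_n(\Gamma)=\min\max_i|\partial A_i|/|A_i|$ and $\iota_n(\Gamma)=\min\max_i|\delta A_i|/|A_i|$, minima over partitions of $V$ into $n$ non-empty disjoint sets $A_1,\dots,A_n$; such a partition attaining the minimum is said to achieve $h_n(\Gamma)$ (resp. $\iota_n(\Gamma)$). For a transitive action of a finite group $G$ on a finite set $V$ and $n\geq2$, a decomposition $V=V_1\sqcup\cdots\sqcup V_n$ into non-empty sets is a system of imprimitivity of size $n$ if for every $g\in G$ there is $\sigma_g\in\mathfrak{S}_n$ with $g\cdot V_i=V_{\sigma_g(i)}$ for all $i$. *)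

theory Defs
  imports
    Complex_Main
    "HOL-Library.Disjoint_Sets"
    "HOL-Combinatorics.Permutations"
    "HOL-Algebra.Group_Action"
begin

text \<open>Edges are two-element sets of vertices. Connectedness is not required.\<close>

locale simple_graph =
  fixes V :: "'a set" and E :: "'a set set"
  assumes finite_V: "finite V"
    and edges: "e \<in> E \<Longrightarrow> \<exists>u\<in>V. \<exists>v\<in>V. u \<noteq> v \<and> e = {u, v}"

text \<open>The elements of \<^term>\<open>BijGroup V\<close> are the extensional bijections of \<^term>\<open>V\<close>,
  so the group below has exactly one element for each automorphism.\<close>

definition aut_group :: "'a set \<Rightarrow> 'a set set \<Rightarrow> ('a \<Rightarrow> 'a) monoid" where
  "aut_group V E = (BijGroup V)
     \<lparr>carrier := {f \<in> Bij V. \<forall>u\<in>V. \<forall>v\<in>V. {f u, f v} \<in> E \<longleftrightarrow> {u, v} \<in> E}\<rparr>"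

definition vertex_transitive :: "'a set \<Rightarrow> 'a set set \<Rightarrow> bool" where
  "vertex_transitive V E \<longleftrightarrow> transitive_action (aut_group V E) V (\<lambda>f. f)"

definition edges_between :: "'a set set \<Rightarrow> 'a set \<Rightarrow> 'a set \<Rightarrow> 'a set set" where
  "edges_between E A B = {e \<in> E. \<exists>a\<in>A. \<exists>b\<in>B. e = {a, b}}"

definition edge_boundary :: "'a set \<Rightarrow> 'a set set \<Rightarrow> 'a set \<Rightarrow> 'a set set" where
  "edge_boundary V E A = edges_between E A (V - A)"

text \<open>The vertex boundary is two-sided: it contains endpoints in \<^term>\<open>A\<close> and outside of it.\<close>

definition vertices_between :: "'a set set \<Rightarrow> 'a set \<Rightarrow> 'a set \<Rightarrow> 'a set" where
  "vertices_between E A B =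
     {a \<in> A. \<exists>e\<in>edges_between E A B. a \<in> e} \<union> {b \<in> B. \<exists>e\<in>edges_between E A B. b \<in> e}"

definition vertex_boundary :: "'a set \<Rightarrow> 'a set set \<Rightarrow> 'a set \<Rightarrow> 'a set" where
  "vertex_boundary V E A = vertices_between E A (V - A)"

text \<open>Only the values of the family at the indices $1,\dots,n$ matter.\<close>

definition decomposition :: "'a set \<Rightarrow> nat \<Rightarrow> (nat \<Rightarrow> 'a set) \<Rightarrow> bool" where
  "decomposition V n A \<longleftrightarrow>
     (\<forall>i\<in>{1..n}. A i \<noteq> {}) \<and> disjoint_family_on A {1..n} \<and> (\<Union>i\<in>{1..n}. A i) = V"

text \<open>The parameter \<^term>\<open>bd\<close> is the edge or the vertex boundary operator of the graph.\<close>

definition max_ratio :: "('a set \<Rightarrow> 'b set) \<Rightarrow> nat \<Rightarrow> (nat \<Rightarrow> 'a set) \<Rightarrow> real" where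
  "max_ratio bd n A = Max ((\<lambda>i. real (card (bd (A i))) / real (card (A i))) ` {1..n})"

definition h :: "'a set \<Rightarrow> 'a set set \<Rightarrow> nat \<Rightarrow> real" where
  "h V E n = Min {max_ratio (edge_boundary V E) n A | A. decomposition V n A}"

definition iota :: "'a set \<Rightarrow> 'a set set \<Rightarrow> nat \<Rightarrow> real" where
  "iota V E n = Min {max_ratio (vertex_boundary V E) n A | A. decomposition V n A}"

definition achieves_h :: "'a set \<Rightarrow> 'a set set \<Rightarrow> nat \<Rightarrow> (nat \<Rightarrow> 'a set) \<Rightarrow> bool" where
  "achieves_h V E n A \<longleftrightarrow>
     decomposition V n A \<and> max_ratio (edge_boundary V E) n A = h V E n"

definition achieves_iota :: "'a set \<Rightarrow> 'a set set \<Rightarrow> nat \<Rightarrow> (nat \<Rightarrow> 'a set) \<Rightarrow> bool" where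
  "achieves_iota V E n A \<longleftrightarrow>
     decomposition V n A \<and> max_ratio (vertex_boundary V E) n A = iota V E n"

text \<open>Meant for transitive actions and \<^term>\<open>n \<ge> (2::nat)\<close>.\<close>

definition system_of_imprimitivity ::
  "('g, 'm) monoid_scheme \<Rightarrow> 'a set \<Rightarrow> ('g \<Rightarrow> 'a \<Rightarrow> 'a) \<Rightarrow> nat \<Rightarrow> (nat \<Rightarrow> 'a set) \<Rightarrow> bool" where
  "system_of_imprimitivity G V \<phi> n P \<longleftrightarrow>
     decomposition V n P \<and>
     (\<forall>g\<in>carrier G. \<exists>\<sigma>. \<sigma> permutes {1..n} \<and> (\<forall>i\<in>{1..n}. \<phi> g ` P i = P (\<sigma> i)))"

definition acts_by_automorphisms ::
  "('g, 'm) monoid_scheme \<Rightarrow> 'a set \<Rightarrow> 'a set set \<Rightarrow> ('g \<Rightarrow> 'a \<Rightarrow> 'a) \<Rightarrow> bool" where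
  "acts_by_automorphisms G V E \<phi> \<longleftrightarrow>
     group_action G V \<phi> \<and> (\<forall>g\<in>carrier G. \<phi> g \<in> carrier (aut_group V E))"


text \<open>The definitions above are meaningful: automorphisms form a group acting on the vertices,
  vertex-transitive graphs are regular, and the minima range over finite non-empty sets.\<close>

lemma subgroup_aut: "subgroup (carrier (aut_group V E)) (BijGroup V)"
proof -
  interpret B: group "BijGroup V" by (rule group_BijGroup)
  have c: "f u \<in> V" if "f \<in> Bij V" "u \<in> V" for f u
    using that Bij_imp_funcset by blast
  show ?thesis
  proof (rule B.subgroupI)
    show "carrier (aut_group V E) \<subseteq> carrier (BijGroup V)"
      by (auto simp: aut_group_def BijGroup_def)
    have "(\<lambda>x\<in>V. x) \<in> carrier (aut_group V E)"
      by (simp add: aut_group_def id_Bij)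
    then show "carrier (aut_group V E) \<noteq> {}" by blast
  next
    fix f assume f: "f \<in> carrier (aut_group V E)"
    then have fB: "f \<in> Bij V" by (simp add: aut_group_def)
    have i: "inv\<^bsub>BijGroup V\<^esub> f = (\<lambda>x\<in>V. inv_into V f x)"
      using fB by (simp add: inv_BijGroup)
    have s: "f (inv_into V f x) = x" "inv_into V f x \<in> V" if "x \<in> V" for x
      using fB that by (auto simp: Bij_def bij_betw_def f_inv_into_f inv_into_into)
    have "{inv_into V f u, inv_into V f v} \<in> E \<longleftrightarrow> {u, v} \<in> E" if "u \<in> V" "v \<in> V" for u v
    proof -
      have "{f (inv_into V f u), f (inv_into V f v)} \<in> E
              \<longleftrightarrow> {inv_into V f u, inv_into V f v} \<in> E"
        using f s(2) that by (simp add: aut_group_def)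
      then show ?thesis using s(1) that by simp
    qed
    then show "inv\<^bsub>BijGroup V\<^esub> f \<in> carrier (aut_group V E)"
      using fB by (simp add: i aut_group_def restrict_inv_into_Bij)
  next
    fix f g assume "f \<in> carrier (aut_group V E)" "g \<in> carrier (aut_group V E)"
    then show "f \<otimes>\<^bsub>BijGroup V\<^esub> g \<in> carrier (aut_group V E)"
      by (auto simp: aut_group_def BijGroup_def compose_Bij compose_eq c)
  qed
qed

lemma group_action_aut: "group_action (aut_group V E) V (\<lambda>f. f)"
proof -
  interpret B: group "BijGroup V" by (rule group_BijGroup)
  have eq: "aut_group V E = (BijGroup V)\<lparr>carrier := carrier (aut_group V E)\<rparr>"
    by (simp add: aut_group_def)
  have "group (aut_group V E)"
    by (subst eq) (rule B.subgroup_imp_group[OF subgroup_aut])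
  moreover have "(\<lambda>f. f) \<in> hom (aut_group V E) (BijGroup V)"
    by (auto simp: hom_def aut_group_def BijGroup_def)
  ultimately show ?thesis
    by (simp add: group_action_def group_hom_def group_hom_axioms_def B.group_axioms)
qed

lemma vertex_transitive_regular:
  assumes "simple_graph V E" "vertex_transitive V E" "u \<in> V" "v \<in> V"
  shows "card {e \<in> E. u \<in> e} = card {e \<in> E. v \<in> e}"
proof -
  interpret simple_graph V E by fact
  have finE: "finite E"
    by (rule finite_subset[of _ "Pow V"]) (use edges finite_V in auto)
  have le: "card {e \<in> E. u \<in> e} \<le> card {e \<in> E. v \<in> e}" if uv: "u \<in> V" "v \<in> V" for u v
  proof -
    interpret T: transitive_action "aut_group V E" V "\<lambda>f. f"
      using assms(2) by (simp add: vertex_transitive_def)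
    obtain f where f: "f \<in> carrier (aut_group V E)" "f u = v"
      using T.unique_orbit uv by blast
    then have inj: "inj_on f V"
      by (simp add: aut_group_def Bij_def bij_betw_def)
    show ?thesis
    proof (rule card_inj_on_le[where f = "\<lambda>e. f ` e"])
      show "inj_on ((`) f) {e \<in> E. u \<in> e}"
        by (rule inj_on_subset[OF inj_on_image_Pow[OF inj]]) (use edges in auto)
      show "(`) f ` {e \<in> E. u \<in> e} \<subseteq> {e \<in> E. v \<in> e}"
      proof clarify
        fix e assume e: "e \<in> E" "u \<in> e"
        then obtain x y where xy: "x \<in> V" "y \<in> V" "e = {x, y}" using edges by blast
        then have "f ` e \<in> E" using f e by (simp add: aut_group_def)
        then show "f ` e \<in> E \<and> v \<in> f ` e" using e f by auto
      qed
      show "finite {e \<in> E. v \<in> e}" using finE by simp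
    qed
  qed
  show ?thesis using le assms(3,4) by (simp add: le_antisym)
qed

lemma finite_max_ratios:
  assumes "finite V"
  shows "finite {max_ratio bd n A | A. decomposition V n A}"
proof (rule finite_subset)
  show "{max_ratio bd n A | A. decomposition V n A}
          \<subseteq> max_ratio bd n ` ({1..n} \<rightarrow>\<^sub>E Pow V)"
  proof clarify
    fix A assume d: "decomposition V n A"
    have "max_ratio bd n A = max_ratio bd n (restrict A {1..n})"
      unfolding max_ratio_def by (intro arg_cong[where f = Max] image_cong) auto
    moreover have "restrict A {1..n} \<in> {1..n} \<rightarrow>\<^sub>E Pow V"
      using d by (auto simp: decomposition_def)
    ultimately show "max_ratio bd n A \<in> max_ratio bd n ` ({1..n} \<rightarrow>\<^sub>E Pow V)" by blast
  qed
  show "finite (max_ratio bd n ` ({1..n} \<rightarrow>\<^sub>E Pow V))"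
    using assms by (intro finite_imageI finite_PiE) auto
qed

lemma ex_decomposition:
  assumes "finite V" "1 \<le> n" "n \<le> card V"
  shows "\<exists>A. decomposition V n A"
proof -
  obtain g where g: "bij_betw g V {1..card V}"
    using ex_bij_betw_nat_finite_1[OF assms(1)] bij_betw_inv by blast
  let ?A = "\<lambda>i. {x \<in> V. min (g x) n = i}"
  have "?A i \<noteq> {}" if i: "i \<in> {1..n}" for i
  proof -
    have "i \<in> g ` V" using g i assms(3) by (simp add: bij_betw_def)
    then obtain x where "x \<in> V" "g x = i" by blast
    then have "x \<in> ?A i" using i by simp
    then show ?thesis by blast
  qed
  moreover have "disjoint_family_on ?A {1..n}"
    unfolding disjoint_family_on_def by blast
  moreover have "(\<Union>i\<in>{1..n}. ?A i) = V"
  proof -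
    have "min (g x) n \<in> {1..n}" if "x \<in> V" for x
      using bij_betwE[OF g] that assms(2) by simp
    then show ?thesis by blast
  qed
  ultimately have "decomposition V n ?A" unfolding decomposition_def by blast
  then show ?thesis by (rule exI[where x = ?A])
qed

lemma ex_min_max_ratio:
  assumes "finite V" "1 \<le> n" "n \<le> card V"
  shows "\<exists>A. decomposition V n A
           \<and> max_ratio bd n A = Min {max_ratio bd n A | A. decomposition V n A}"
proof -
  have "Min {max_ratio bd n A | A. decomposition V n A}
          \<in> {max_ratio bd n A | A. decomposition V n A}"
    using ex_decomposition[OF assms] by (intro Min_in finite_max_ratios assms(1)) auto
  then show ?thesis by force
qed

lemma ex_achieves:
  assumes "finite V" "1 \<le> n" "n \<le> card V"
  shows "\<exists>A. achieves_h V E n A" "\<exists>A. achieves_iota V E n A"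
  unfolding achieves_h_def h_def achieves_iota_def iota_def
  by (rule ex_min_max_ratio[OF assms])+

end

theory Submission
  imports Defs
begin

text \<open>Let $\varepsilon$ be the ratio $h_n / h_{n+1} < 1/(2(n+1))$ and consider all translates
  $gA_i$ of the parts of an optimal partition. Replacing one part $S$ by $S \cap T$ and
  $S \setminus T$ gives $n+1$ sets, so for two translates one of these pieces has at most
  $\varepsilon (|S| + |T|)$ elements. Calling $S$ and $T$ close when $S \cap T$ is the larger piece
  defines an equivalence relation, because $6 \varepsilon < 1$. Averaging over the group shows that
  no part has fewer than $|V|/(n+1)$ elements, and this forces every $gA$ to match $A$ part by part.
  The union of the matched intersections misses at most $2 \varepsilon |V|$ vertices, since its boundary
  has size at most $2 h_n |V|$. The block $V_i$ consists of the vertices that lie in the translate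
  matched with $A_i$ for more than half of the group. Only subadditivity, symmetry under complement and
  invariance of the boundary are used, so edge and vertex boundaries are treated alike.\<close>

text \<open>Double counting of the pairs (x, g) with x in \<open>Y g\<close>. With \<open>I\<close>
  the group it turns a count of group elements at each vertex into an average of set sizes over the
  translates.\<close>

lemma sum_card_incidence:
  assumes "finite X" "finite I"
  shows "(\<Sum>x\<in>X. card {g \<in> I. x \<in> Y g}) = (\<Sum>g\<in>I. card (X \<inter> Y g))"
proof -
  have "(\<Sum>x\<in>X. card {g \<in> I. x \<in> Y g}) = (\<Sum>x\<in>X. \<Sum>g\<in>I. if x \<in> Y g then 1 else 0)"
    using assms by (intro sum.cong) (simp_all add: sum.If_cases Int_def)
  also have "\<dots> = (\<Sum>g\<in>I. \<Sum>x\<in>X. if x \<in> Y g then 1 else 0)"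
    by (rule sum.swap)
  also have "\<dots> = (\<Sum>g\<in>I. card (X \<inter> Y g))"
    using assms by (intro sum.cong) (simp_all add: sum.If_cases Int_def)
  finally show ?thesis .
qed

lemma decomposition_sum_card:
  assumes "finite V" "decomposition V n B"
  shows "(\<Sum>i\<in>{1..n}. card (B i)) = card V"
proof -
  have "card (\<Union>i\<in>{1..n}. B i) = (\<Sum>i\<in>{1..n}. card (B i))"
    using assms
    by (intro card_UN_disjoint)
       (auto simp: decomposition_def disjoint_family_on_def intro: finite_subset)
  then show ?thesis using assms by (simp add: decomposition_def)
qed

lemma decomposition_part:
  assumes "decomposition V n B" "i \<in> {1..n}"
  shows "B i \<subseteq> V" "B i \<noteq> {}"
  using assms by (auto simp: decomposition_def)

lemma decomposition_disjoint:
  assumes "decomposition V n B" "i \<in> {1..n}" "j \<in> {1..n}" "i \<noteq> j"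
  shows "B i \<inter> B j = {}"
  using assms by (auto simp: decomposition_def disjoint_family_on_def)

section \<open>Boundary operators and the ratio gap\<close>

text \<open>Boundary elements have a type of their own, since they are edges in one instance and
  vertices in the other. The inclusion \<open>bd_compl\<close> amounts to an equality, as one sees
  by applying it to \<open>V - X\<close>.\<close>

locale boundary_operator =
  fixes V :: "'a set" and bd :: "'a set \<Rightarrow> 'b set"
  assumes finite_V: "finite V"
    and finite_bd: "X \<subseteq> V \<Longrightarrow> finite (bd X)"
    and bd_empty: "bd {} = {}"
    and bd_Un: "X \<subseteq> V \<Longrightarrow> Y \<subseteq> V \<Longrightarrow> bd (X \<union> Y) \<subseteq> bd X \<union> bd Y"
    and bd_compl: "X \<subseteq> V \<Longrightarrow> bd (V - X) \<subseteq> bd X"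
begin

lemma bd_Int:
  assumes "X \<subseteq> V" "Y \<subseteq> V"
  shows "bd (X \<inter> Y) \<subseteq> bd X \<union> bd Y"
proof -
  have "X \<inter> Y = V - ((V - X) \<union> (V - Y))" using assms by blast
  then have "bd (X \<inter> Y) \<subseteq> bd ((V - X) \<union> (V - Y))"
    using bd_compl[of "(V - X) \<union> (V - Y)"] by simp
  also have "\<dots> \<subseteq> bd (V - X) \<union> bd (V - Y)" by (rule bd_Un) auto
  also have "\<dots> \<subseteq> bd X \<union> bd Y" using bd_compl assms by blast
  finally show ?thesis .
qed

lemma bd_Diff:
  assumes "X \<subseteq> V" "Y \<subseteq> V"
  shows "bd (X - Y) \<subseteq> bd X \<union> bd Y"
proof -
  have "X - Y = X \<inter> (V - Y)" using assms by blast
  then show ?thesis using bd_Int[of X "V - Y"] bd_compl[of Y] assms by auto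
qed

lemma bd_UN:
  assumes "finite I" "\<And>i. i \<in> I \<Longrightarrow> C i \<subseteq> V"
  shows "bd (\<Union>i\<in>I. C i) \<subseteq> (\<Union>i\<in>I. bd (C i))"
  using assms
proof (induction I)
  case empty
  then show ?case by (simp add: bd_empty)
next
  case (insert i I)
  have "bd (C i \<union> (\<Union>j\<in>I. C j)) \<subseteq> bd (C i) \<union> bd (\<Union>j\<in>I. C j)"
    using insert.prems by (intro bd_Un UN_least) auto
  also have "\<dots> \<subseteq> bd (C i) \<union> (\<Union>j\<in>I. bd (C j))" using insert by blast
  finally show ?case by simp
qed

end

text \<open>In the instances \<open>a\<close> and \<open>b\<close> are h_n and h_{n+1}, or the
  corresponding values of iota. The ratio bounds are multiplied out, so that an empty set satisfies
  them trivially.\<close>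

locale ratio_gap = transitive_action G V \<phi> + boundary_operator V bd
  for G :: "('g, 'm) monoid_scheme" (structure) and V :: "'a set" and \<phi>
    and bd :: "'a set \<Rightarrow> 'b set" +
  fixes A :: "nat \<Rightarrow> 'a set" and n :: nat and a b :: real
  assumes finite_G: "finite (carrier G)"
    and card_bd_image: "g \<in> carrier G \<Longrightarrow> X \<subseteq> V \<Longrightarrow> card (bd (\<phi> g ` X)) \<le> card (bd X)"
    and two_le_n: "2 \<le> n"
    and decomp: "decomposition V n A"
    and card_bd_part: "i \<in> {1..n} \<Longrightarrow> real (card (bd (A i))) \<le> a * real (card (A i))"
    and gap: "2 * (real n + 1) * a < b"
    and wide: "decomposition V (n + 1) B \<Longrightarrow>
      \<exists>i\<in>{1..n + 1}. b * real (card (B i)) \<le> real (card (bd (B i)))"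
begin

section \<open>The action on subsets and averages over the group\<close>

sublocale group G
  using group_hom group_hom.axioms(1) by blast

lemma finite_sub: "X \<subseteq> V \<Longrightarrow> finite X"
  using finite_V finite_subset by blast

lemma image_sub: "g \<in> carrier G \<Longrightarrow> X \<subseteq> V \<Longrightarrow> \<phi> g ` X \<subseteq> V"
  using element_image by blast

lemma card_image_eq: "g \<in> carrier G \<Longrightarrow> X \<subseteq> V \<Longrightarrow> card (\<phi> g ` X) = card X"
  using inj_prop card_image inj_on_subset by blast

lemma image_mult:
  assumes "k \<in> carrier G" "g \<in> carrier G" "X \<subseteq> V"
  shows "\<phi> (k \<otimes> g) ` X = \<phi> k ` \<phi> g ` X"
  unfolding image_image using assms composition_rule by (intro image_cong) auto

lemma mem_image_iff:
  assumes "g \<in> carrier G" "X \<subseteq> V" "v \<in> V"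
  shows "\<phi> g v \<in> \<phi> g ` X \<longleftrightarrow> v \<in> X"
  using inj_on_image_mem_iff[OF inj_prop[OF assms(1)]] assms by blast

lemma image_one: "X \<subseteq> V \<Longrightarrow> \<phi> \<one> ` X = X"
  using id_eq_one by (force simp flip: id_eq_one)

lemma card_translate:
  assumes "k \<in> carrier G"
  shows "card {g \<in> carrier G. Q (k \<otimes> g)} = card {g \<in> carrier G. Q g}"
proof (rule bij_betw_same_card[of "\<lambda>g. k \<otimes> g"])
  show "bij_betw (\<lambda>g. k \<otimes> g) {g \<in> carrier G. Q (k \<otimes> g)} {g \<in> carrier G. Q g}"
  proof (rule bij_betwI[where g = "\<lambda>g. inv k \<otimes> g"])
  qed (use assms in \<open>auto simp: m_assoc[symmetric]\<close>)
qed

lemma card_carrier_pos: "0 < card (carrier G)"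
  using finite_G by (auto simp: card_gt_0_iff)

text \<open>For a random g the expected size of the intersection of X with gY is |X||Y|/|V|. By
  transitivity the number \<open>F v\<close> of translates of Y that contain v is the same for all
  v, and summing over \<open>V\<close> determines its value.\<close>

lemma sum_card_Int_image:
  assumes "X \<subseteq> V" "Y \<subseteq> V"
  shows "card V * (\<Sum>g\<in>carrier G. card (X \<inter> \<phi> g ` Y)) = card (carrier G) * card X * card Y"
proof (cases "V = {}")
  case True
  then show ?thesis using assms by simp
next
  case False
  then obtain w where w: "w \<in> V" by blast
  define F where "F v = card {g \<in> carrier G. v \<in> \<phi> g ` Y}" for v
  have F: "F v = F w" if "v \<in> V" for v
  proof -
    obtain k where k: "k \<in> carrier G" "\<phi> k w = v" using unique_orbit w \<open>v \<in> V\<close> by blast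
    have "F v = card {g \<in> carrier G. v \<in> \<phi> (k \<otimes> g) ` Y}"
      unfolding F_def by (rule card_translate[OF k(1), symmetric])
    also have "{g \<in> carrier G. v \<in> \<phi> (k \<otimes> g) ` Y} = {g \<in> carrier G. w \<in> \<phi> g ` Y}"
    proof (rule Collect_cong, rule conj_cong[OF refl])
      fix g assume g: "g \<in> carrier G"
      show "v \<in> \<phi> (k \<otimes> g) ` Y \<longleftrightarrow> w \<in> \<phi> g ` Y"
        unfolding image_mult[OF k(1) g assms(2)] k(2)[symmetric]
        by (rule mem_image_iff[OF k(1) image_sub[OF g assms(2)] w])
    qed
    finally show ?thesis by (simp add: F_def)
  qed
  have sumF: "(\<Sum>g\<in>carrier G. card (Z \<inter> \<phi> g ` Y)) = card Z * F w" if "Z \<subseteq> V" for Z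
  proof -
    have "(\<Sum>g\<in>carrier G. card (Z \<inter> \<phi> g ` Y)) = (\<Sum>v\<in>Z. F v)"
      unfolding F_def using sum_card_incidence[OF finite_sub[OF that] finite_G, of "\<lambda>g. \<phi> g ` Y"]
      by simp
    also have "\<dots> = (\<Sum>v\<in>Z. F w)" using F that by (intro sum.cong) auto
    finally show ?thesis by simp
  qed
  have "card V * F w = (\<Sum>g\<in>carrier G. card (V \<inter> \<phi> g ` Y))" using sumF[of V] by simp
  also have "\<dots> = (\<Sum>g\<in>carrier G. card Y)"
    using image_sub[OF _ assms(2)] card_image_eq[OF _ assms(2)]
    by (intro sum.cong) (auto simp: Int_absorb1)
  finally have "card V * F w = card (carrier G) * card Y" by simp
  then show ?thesis using sumF[OF assms(1)] by (simp add: mult.left_commute mult.commute)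
qed

section \<open>The ratio of the two constants and the test on n + 1 sets\<close>

definition \<epsilon> :: real where "\<epsilon> = a / b"

lemma card_part_pos: "i \<in> {1..n} \<Longrightarrow> 0 < card (A i)"
  using decomposition_part[OF decomp] finite_sub by (simp add: card_gt_0_iff)

lemma a_nonneg: "0 \<le> a"
proof -
  have 1: "1 \<in> {1..n}" using two_le_n by simp
  have "0 \<le> a * real (card (A 1))" using card_bd_part[OF 1] by linarith
  then show ?thesis using card_part_pos[OF 1] by (simp add: zero_le_mult_iff)
qed

lemma b_pos: "0 < b"
proof -
  have "0 \<le> 2 * (real n + 1) * a" using a_nonneg by (intro mult_nonneg_nonneg) auto
  then show ?thesis using gap by linarith
qed

lemma eps_nonneg: "0 \<le> \<epsilon>"
  using a_nonneg b_pos by (simp add: \<epsilon>_def)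

lemma eps_less: "2 * (real n + 1) * \<epsilon> < 1"
  using gap b_pos by (simp add: \<epsilon>_def field_simps)

text \<open>From n at least 2, the factor 2(n + 1) is at least 6.\<close>

lemma six_eps_less: "6 * \<epsilon> < 1"
proof -
  have "3 * (2 * \<epsilon>) \<le> (real n + 1) * (2 * \<epsilon>)"
    using two_le_n eps_nonneg by (intro mult_right_mono) auto
  then show ?thesis using eps_less by linarith
qed

text \<open>The n disjoint sets and what they leave over form the partition to which
  \<open>wide\<close> applies. If one of these n + 1 sets is empty, that set itself satisfies the
  inequality, so nothing has to be checked for non-emptiness.\<close>

lemma wide_family:
  assumes sub: "\<And>i. i \<in> {1..n} \<Longrightarrow> C i \<subseteq> V" and disj: "disjoint_family_on C {1..n}"
  shows "\<exists>X\<in>insert (V - (\<Union>i\<in>{1..n}. C i)) (C ` {1..n}).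
    b * real (card X) \<le> real (card (bd X))"
proof (cases "{} \<in> insert (V - (\<Union>i\<in>{1..n}. C i)) (C ` {1..n})")
  case True
  then show ?thesis by (intro bexI[of _ "{}"]) auto
next
  case False
  define R where "R = V - (\<Union>i\<in>{1..n}. C i)"
  have eq: "{1..n + 1} = insert (n + 1) {1..n}" by auto
  have "decomposition V (n + 1) (C(n + 1 := R))"
    unfolding decomposition_def
  proof (intro conjI)
    show "\<forall>i\<in>{1..n + 1}. (C(n + 1 := R)) i \<noteq> {}" using False by (auto simp: R_def)
    have "(C(n + 1 := R)) i \<inter> (C(n + 1 := R)) j = {}"
      if "i \<in> {1..n + 1}" "j \<in> {1..n + 1}" "i \<noteq> j" for i j
    proof (cases "i = n + 1 \<or> j = n + 1")
      case True
      then show ?thesis using that by (auto simp: R_def)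
    next
      case False
      then show ?thesis using that disj by (simp add: disjoint_family_on_def)
    qed
    then show "disjoint_family_on (C(n + 1 := R)) {1..n + 1}"
      unfolding disjoint_family_on_def by blast
    have "(\<Union>i\<in>{1..n + 1}. (C(n + 1 := R)) i) = R \<union> (\<Union>i\<in>{1..n}. C i)"
      unfolding eq by auto
    also have "\<dots> = V" using sub unfolding R_def by blast
    finally show "(\<Union>i\<in>{1..n + 1}. (C(n + 1 := R)) i) = V" .
  qed
  from wide[OF this] obtain i where i: "i \<in> {1..n + 1}"
    "b * real (card ((C(n + 1 := R)) i)) \<le> real (card (bd ((C(n + 1 := R)) i)))" by blast
  then have "(C(n + 1 := R)) i \<in> insert R (C ` {1..n})" by auto
  then show ?thesis using i(2) unfolding R_def by blast
qed

lemma card_le_eps: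
  assumes "b * real (card X) \<le> real (card (bd X))" "real (card (bd X)) \<le> a * m"
  shows "real (card X) \<le> \<epsilon> * m"
proof -
  have "b * real (card X) \<le> a * m" using assms by linarith
  then show ?thesis using b_pos by (simp add: \<epsilon>_def field_simps)
qed

section \<open>Cutting one set of small ratio by another\<close>

definition tight :: "'a set \<Rightarrow> bool" where
  "tight X \<longleftrightarrow> X \<subseteq> V \<and> X \<noteq> {} \<and> real (card (bd X)) \<le> a * real (card X)"

lemma tight_sub: "tight X \<Longrightarrow> X \<subseteq> V"
  by (simp add: tight_def)

lemma tight_card_pos: "tight X \<Longrightarrow> 0 < card X"
  using finite_sub by (auto simp: tight_def card_gt_0_iff)

lemma tight_not_wide:
  assumes "tight X"
  shows "\<not> b * real (card X) \<le> real (card (bd X))"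
proof
  assume "b * real (card X) \<le> real (card (bd X))"
  then have "real (card X) \<le> \<epsilon> * real (card X)"
    by (rule card_le_eps) (use assms in \<open>simp add: tight_def\<close>)
  moreover have "6 * \<epsilon> * real (card X) < 1 * real (card X)"
    using six_eps_less tight_card_pos[OF assms] by (intro mult_strict_right_mono) auto
  ultimately show False using eps_nonneg by auto
qed

lemma card_bd_le_sum:
  assumes "bd Z \<subseteq> bd X \<union> bd Y" "tight X" "tight Y"
  shows "real (card (bd Z)) \<le> a * (real (card X) + real (card Y))"
proof -
  have "card (bd Z) \<le> card (bd X \<union> bd Y)"
    using assms finite_bd by (intro card_mono) (auto simp: tight_def)
  also have "\<dots> \<le> card (bd X) + card (bd Y)" by (rule card_Un_le)
  finally have "real (card (bd Z)) \<le> real (card (bd X)) + real (card (bd Y))" by linarith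
  then show ?thesis using assms by (simp add: tight_def algebra_simps)
qed

text \<open>Shrinking \<open>B i\<close> to its intersection with \<open>T\<close> leaves exactly
  \<open>B i - T\<close> over. One of the resulting n + 1 sets must have ratio at least
  \<open>b\<close>, and an untouched part is tight, so it is one of the two pieces of
  \<open>B i\<close>. Its boundary lies in those of \<open>B i\<close> and \<open>T\<close>, which
  bounds its size by \<open>card_le_eps\<close>.\<close>

lemma Int_or_Diff_small:
  assumes B: "decomposition V n B" "\<And>j. j \<in> {1..n} \<Longrightarrow> tight (B j)"
    and T: "tight T" and i: "i \<in> {1..n}"
  shows "real (card (B i \<inter> T)) \<le> \<epsilon> * (real (card (B i)) + real (card T))
    \<or> real (card (B i - T)) \<le> \<epsilon> * (real (card (B i)) + real (card T))"
proof -
  note disj = decomposition_disjoint[OF B(1)]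
  define C where "C = B(i := B i \<inter> T)"
  have sub: "C j \<subseteq> B j" for j by (simp add: C_def)
  have wide_C: "\<exists>X\<in>insert (V - (\<Union>j\<in>{1..n}. C j)) (C ` {1..n}).
      b * real (card X) \<le> real (card (bd X))"
  proof (rule wide_family)
    show "C j \<subseteq> V" if "j \<in> {1..n}" for j using sub tight_sub B(2) that by blast
    show "disjoint_family_on C {1..n}"
      unfolding disjoint_family_on_def using sub disj by blast
  qed
  have rest: "V - (\<Union>j\<in>{1..n}. C j) = B i - T"
  proof -
    have V: "V = (\<Union>j\<in>{1..n}. B j)" using B(1) by (simp add: decomposition_def)
    have C: "C i = B i \<inter> T" "\<And>j. j \<noteq> i \<Longrightarrow> C j = B j" by (simp_all add: C_def)
    show ?thesis
    proof (intro equalityI subsetI DiffI)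
      fix x assume x: "x \<in> V - (\<Union>j\<in>{1..n}. C j)"
      then obtain j where j: "j \<in> {1..n}" "x \<in> B j" using V by blast
      then have "j = i" using x C(2) by blast
      then show "x \<in> B i" "x \<notin> T" using x j C(1) by blast+
    next
      fix x assume x: "x \<in> B i - T"
      then show "x \<in> V" using V i by blast
      have "x \<notin> C j" if "j \<in> {1..n}" for j
        using x disj[OF i that] C by (cases "j = i") auto
      then show "x \<notin> (\<Union>j\<in>{1..n}. C j)" by blast
    qed
  qed
  obtain X where X: "X \<in> insert (B i - T) (C ` {1..n})"
    "b * real (card X) \<le> real (card (bd X))" using wide_C unfolding rest by blast
  have "X = B i - T \<or> X = B i \<inter> T"
  proof (rule ccontr)
    assume neq: "\<not> ?thesis"
    then obtain j where j: "j \<in> {1..n}" "X = C j" using X(1) by blast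
    then have "X = B j" using neq by (cases "j = i") (simp_all add: C_def)
    then show False using tight_not_wide[OF B(2)[OF j(1)]] X(2) by blast
  qed
  then have "bd X \<subseteq> bd (B i) \<union> bd T"
    using bd_Diff[OF tight_sub[OF B(2)[OF i]] tight_sub[OF T]]
      bd_Int[OF tight_sub[OF B(2)[OF i]] tight_sub[OF T]] by auto
  then have "real (card X) \<le> \<epsilon> * (real (card (B i)) + real (card T))"
    using card_le_eps[OF X(2) card_bd_le_sum[OF _ B(2)[OF i] T]] by blast
  then show ?thesis using \<open>X = B i - T \<or> X = B i \<inter> T\<close> by blast
qed

text \<open>Here \<open>T\<close> is cut out of all parts at once. What is left over is
  \<open>T\<close> itself, which is tight, so one of the trimmed parts has large ratio and must be
  small.\<close>

lemma ex_Diff_small: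
  assumes B: "decomposition V n B" "\<And>j. j \<in> {1..n} \<Longrightarrow> tight (B j)" and T: "tight T"
  shows "\<exists>i\<in>{1..n}. real (card (B i - T)) \<le> \<epsilon> * (real (card (B i)) + real (card T))"
proof -
  have "\<exists>X\<in>insert (V - (\<Union>j\<in>{1..n}. B j - T)) ((\<lambda>j. B j - T) ` {1..n}).
      b * real (card X) \<le> real (card (bd X))"
  proof (rule wide_family)
    show "B j - T \<subseteq> V" if "j \<in> {1..n}" for j using tight_sub B(2) that by blast
    show "disjoint_family_on (\<lambda>j. B j - T) {1..n}"
      unfolding disjoint_family_on_def using decomposition_disjoint[OF B(1)] by blast
  qed
  moreover have "V - (\<Union>j\<in>{1..n}. B j - T) = T"
    using B(1) tight_sub[OF T] by (auto simp: decomposition_def)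
  ultimately obtain X where X: "X = T \<or> X \<in> (\<lambda>j. B j - T) ` {1..n}"
    "b * real (card X) \<le> real (card (bd X))" by auto
  then obtain j where j: "j \<in> {1..n}" "X = B j - T"
    using tight_not_wide T by blast
  then have "bd X \<subseteq> bd (B j) \<union> bd T"
    using bd_Diff tight_sub B(2) T by blast
  then have "real (card X) \<le> \<epsilon> * (real (card (B j)) + real (card T))"
    using X(2) B(2) j(1) T card_bd_le_sum card_le_eps by blast
  then show ?thesis using j by blast
qed

section \<open>Translates of the partition and lower bounds for the parts\<close>

lemma tight_image:
  assumes "g \<in> carrier G" "tight X"
  shows "tight (\<phi> g ` X)"
proof -
  have "card (bd (\<phi> g ` X)) \<le> card (bd X)" "card (\<phi> g ` X) = card X"
    using assms card_bd_image card_image_eq tight_sub by auto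
  then show ?thesis using assms image_sub[OF assms(1), of X]
    by (auto simp: tight_def intro: order_trans[of _ "real (card (bd X))"])
qed

lemma tight_part: "i \<in> {1..n} \<Longrightarrow> tight (A i)"
  using decomposition_part[OF decomp] card_bd_part by (simp add: tight_def)

lemma part_sub: "i \<in> {1..n} \<Longrightarrow> A i \<subseteq> V"
  using decomposition_part[OF decomp] by blast

lemma decomposition_image:
  assumes "g \<in> carrier G" "decomposition V n B"
  shows "decomposition V n (\<lambda>i. \<phi> g ` B i)"
  unfolding decomposition_def disjoint_family_on_def
proof (intro conjI ballI impI)
  fix i j assume ij: "i \<in> {1..n}" "j \<in> {1..n}" "i \<noteq> j"
  have "\<phi> g ` B i \<inter> \<phi> g ` B j = \<phi> g ` (B i \<inter> B j)"
    using inj_on_image_Int[OF inj_prop[OF assms(1)]] decomposition_part[OF assms(2)] ij by simp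
  then show "\<phi> g ` B i \<inter> \<phi> g ` B j = {}"
    using decomposition_disjoint[OF assms(2) ij] by simp
next
  have "(\<Union>i\<in>{1..n}. \<phi> g ` B i) = \<phi> g ` V"
    using assms(2) by (simp add: decomposition_def flip: image_UN)
  then show "(\<Union>i\<in>{1..n}. \<phi> g ` B i) = V" using surj_prop[OF assms(1)] by simp
qed (use assms(2) in \<open>auto simp: decomposition_def\<close>)

text \<open>For the smallest part $A_m$, every $g$ admits an $i$ such that $gA_m$ covers all but the fraction
  $2 \varepsilon$ of $A_i$. Hence $\sum_i |A_i \cap gA_m| / |A_i| \ge 1 - 2 \varepsilon$ for all $g$, whereas the
  average over $g$ of the left-hand side is $n |A_m| / |V|$.\<close>

lemma part_large:
  assumes j: "j \<in> {1..n}"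
  shows "real (card V) < (real n + 1) * real (card (A j))"
proof -
  obtain m where m: "m \<in> {1..n}" "\<And>i. i \<in> {1..n} \<Longrightarrow> card (A m) \<le> card (A i)"
    using ex_has_least_nat[of "\<lambda>i. i \<in> {1..n}" j "\<lambda>i. card (A i)"] j by blast
  let ?ratio = "\<lambda>g i. real (card (A i \<inter> \<phi> g ` A m)) / real (card (A i))"
  have low: "1 - 2 * \<epsilon> \<le> (\<Sum>i\<in>{1..n}. ?ratio g i)" if g: "g \<in> carrier G" for g
  proof -
    obtain i where i: "i \<in> {1..n}"
      "real (card (A i - \<phi> g ` A m)) \<le> \<epsilon> * (real (card (A i)) + real (card (\<phi> g ` A m)))"
      using ex_Diff_small[OF decomp tight_part tight_image[OF g tight_part[OF m(1)]]] by blast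
    have "real (card (A i)) = real (card (A i - \<phi> g ` A m)) + real (card (A i \<inter> \<phi> g ` A m))"
      using card_Diff_subset_Int[of "A i" "\<phi> g ` A m"] finite_sub[OF part_sub[OF i(1)]]
        card_mono[of "A i" "A i \<inter> \<phi> g ` A m"] by simp
    moreover have "\<epsilon> * (real (card (A i)) + real (card (\<phi> g ` A m))) \<le> \<epsilon> * (2 * real (card (A i)))"
      using card_image_eq[OF g part_sub[OF m(1)]] m(2)[OF i(1)] eps_nonneg
      by (intro mult_left_mono) auto
    ultimately have "(1 - 2 * \<epsilon>) * real (card (A i)) \<le> real (card (A i \<inter> \<phi> g ` A m))"
      using i(2) by (simp add: algebra_simps)
    then have "1 - 2 * \<epsilon> \<le> ?ratio g i" using card_part_pos[OF i(1)] by (simp add: field_simps)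
    also have "\<dots> \<le> (\<Sum>i\<in>{1..n}. ?ratio g i)" using i(1) by (intro member_le_sum) auto
    finally show ?thesis .
  qed
  have N: "0 < card V" using card_part_pos[OF j] card_mono[OF finite_V part_sub[OF j]] by linarith
  have "(1 - 2 * \<epsilon>) * real (card (carrier G)) = (\<Sum>g\<in>carrier G. 1 - 2 * \<epsilon>)" by simp
  also have "\<dots> \<le> (\<Sum>g\<in>carrier G. \<Sum>i\<in>{1..n}. ?ratio g i)" by (intro sum_mono low)
  also have "\<dots> = (\<Sum>i\<in>{1..n}. \<Sum>g\<in>carrier G. ?ratio g i)" by (rule sum.swap)
  also have "\<dots> = (\<Sum>i\<in>{1..n}. real (card (carrier G)) * real (card (A m)) / real (card V))"
  proof (rule sum.cong[OF refl])
    fix i assume i: "i \<in> {1..n}"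
    have "real (card V) * (\<Sum>g\<in>carrier G. real (card (A i \<inter> \<phi> g ` A m)))
        = real (card (carrier G)) * real (card (A i)) * real (card (A m))"
      using arg_cong[OF sum_card_Int_image[OF part_sub[OF i] part_sub[OF m(1)]], of real] by simp
    then show "(\<Sum>g\<in>carrier G. ?ratio g i) = real (card (carrier G)) * real (card (A m)) / real (card V)"
      using card_part_pos[OF i] N by (simp add: sum_divide_distrib[symmetric] field_simps)
  qed
  also have "\<dots> = (real n * real (card (A m)) / real (card V)) * real (card (carrier G))" by simp
  finally have "1 - 2 * \<epsilon> \<le> real n * real (card (A m)) / real (card V)"
    using card_carrier_pos by (metis mult_le_cancel_right_pos of_nat_0_less_iff)
  then have "(1 - 2 * \<epsilon>) * real (card V) \<le> real n * real (card (A m))"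
    using N by (simp add: field_simps)
  \<comment> \<open>The right-hand side is n + 1 - 2(n + 1)\<open>\<epsilon>\<close>. The factor 2(n
    + 1) in the gap hypothesis is exactly what makes the subtracted term less than 1.\<close>
  moreover have "real n < (real n + 1) * (1 - 2 * \<epsilon>)"
    using eps_less by (simp add: algebra_simps)
  then have "real n * real (card V) < (real n + 1) * (1 - 2 * \<epsilon>) * real (card V)"
    using N by (intro mult_strict_right_mono) auto
  ultimately have "real n * real (card V) < (real n + 1) * (real n * real (card (A m)))"
    using mult_left_mono[of "(1 - 2 * \<epsilon>) * real (card V)" "real n * real (card (A m))" "real n + 1"]
    unfolding mult.assoc[of "real n + 1" "1 - 2 * \<epsilon>"] by linarith
  then have "real n * real (card V) < real n * ((real n + 1) * real (card (A m)))"
    by (simp add: algebra_simps)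
  then have "real (card V) < (real n + 1) * real (card (A m))"
    using two_le_n by (simp only: mult_less_cancel_left_pos)
  also have "\<dots> \<le> (real n + 1) * real (card (A j))"
    using m(2)[OF j] by (intro mult_left_mono) auto
  finally show ?thesis .
qed

text \<open>For distinct indices the two parts have at most |V| elements together,
  2\<open>\<epsilon>\<close> is less than 1/(n + 1), and |V|/(n + 1) is less than |A_i| by
  \<open>part_large\<close>. For equal indices, 4\<open>\<epsilon>\<close> is less than 1.
  Consequently an error of \<open>\<epsilon>\<close> times the two sizes is less than half of
  \<open>A i\<close>.\<close>

lemma two_eps_card_less:
  assumes i: "i \<in> {1..n}" and j: "j \<in> {1..n}"
  shows "2 * \<epsilon> * (real (card (A i)) + real (card (A j))) < real (card (A i))"
proof (cases "i = j")
  case True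
  have "6 * \<epsilon> * real (card (A i)) < 1 * real (card (A i))"
    using six_eps_less card_part_pos[OF i] by (intro mult_strict_right_mono) auto
  moreover have "0 \<le> \<epsilon> * real (card (A i))" using eps_nonneg by simp
  moreover have "2 * \<epsilon> * (real (card (A i)) + real (card (A i))) = 4 * (\<epsilon> * real (card (A i)))"
    by (simp add: algebra_simps)
  ultimately show ?thesis unfolding True[symmetric] by linarith
next
  case False
  let ?N = "real (card V)" and ?m = "real n + 1"
  have "?N = (\<Sum>k\<in>{1..n}. real (card (A k)))"
    using decomposition_sum_card[OF finite_V decomp] by (simp flip: of_nat_sum)
  also have "\<dots> = (\<Sum>k\<in>{i,j}. real (card (A k))) + (\<Sum>k\<in>{1..n} - {i,j}. real (card (A k)))"
    using i j by (subst sum.subset_diff[of "{i,j}"]) auto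
  finally have s: "?N = real (card (A i)) + real (card (A j))
      + (\<Sum>k\<in>{1..n} - {i,j}. real (card (A k)))" using False by simp
  have "card ({1..n} - {i,j}) = n - 2"
    using i j False by (subst card_Diff_subset) auto
  \<comment> \<open>The other n - 2 parts have more than |V|/(n + 1) elements each, which leaves at
    most 3|V|/(n + 1) for these two, and this is at most |V|.\<close>
  then have "(real n - 2) * (?N / ?m) = (\<Sum>k\<in>{1..n} - {i,j}. ?N / ?m)"
    using two_le_n by simp
  also have "\<dots> \<le> (\<Sum>k\<in>{1..n} - {i,j}. real (card (A k)))"
    using part_large by (intro sum_mono) (force simp: field_simps)
  finally have "real (card (A i)) + real (card (A j)) \<le> ?N - (real n - 2) * (?N / ?m)"
    using s by linarith
  also have "\<dots> = 3 * ?N / ?m" by (simp add: field_simps)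
  also have "\<dots> \<le> ?N" using two_le_n mult_right_mono[of 2 "real n" ?N] by (simp add: field_simps)
  finally have sum: "real (card (A i)) + real (card (A j)) \<le> ?N" .
  have "?m * (2 * \<epsilon> * (real (card (A i)) + real (card (A j))))
      = (2 * ?m * \<epsilon>) * (real (card (A i)) + real (card (A j)))"
    by (simp only: mult.assoc mult.left_commute)
  also have "\<dots> \<le> 1 * (real (card (A i)) + real (card (A j)))"
    using eps_less by (intro mult_right_mono) auto
  also have "\<dots> \<le> ?N" using sum by simp
  also have "\<dots> < ?m * real (card (A i))" by (rule part_large[OF i])
  finally show ?thesis by (simp only: mult_less_cancel_left_pos)
qed

section \<open>Matching the translates\<close>

text \<open>The threshold is the one in \<open>Int_or_Diff_small\<close>: once the intersection
  exceeds it, the difference has to be the small piece.\<close>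

definition close :: "'a set \<Rightarrow> 'a set \<Rightarrow> bool" where
  "close S T \<longleftrightarrow> \<epsilon> * (real (card S) + real (card T)) < real (card (S \<inter> T))"

definition part :: "'a set \<Rightarrow> bool" where
  "part T \<longleftrightarrow> (\<exists>g\<in>carrier G. \<exists>i\<in>{1..n}. T = \<phi> g ` A i)"

lemma part_image: "g \<in> carrier G \<Longrightarrow> i \<in> {1..n} \<Longrightarrow> part (\<phi> g ` A i)"
  unfolding part_def by blast

lemma part_A: "i \<in> {1..n} \<Longrightarrow> part (A i)"
  unfolding part_def using image_one[OF part_sub] one_closed by metis

lemma part_tight: "part T \<Longrightarrow> tight T"
  using tight_image tight_part by (auto simp: part_def)

lemma close_sym: "close S T \<longleftrightarrow> close T S"
  by (simp add: close_def Int_commute add.commute)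

lemma close_image:
  assumes "g \<in> carrier G" "S \<subseteq> V" "T \<subseteq> V" "close S T"
  shows "close (\<phi> g ` S) (\<phi> g ` T)"
proof -
  have "card (\<phi> g ` S \<inter> \<phi> g ` T) = card (S \<inter> T)"
    using assms inj_on_image_Int[OF inj_prop[OF assms(1)], of S T] card_image_eq[of g "S \<inter> T"]
    by (simp add: le_infI1)
  then show ?thesis using assms by (simp add: close_def card_image_eq)
qed

text \<open>Being a translate of some \<open>A i\<close>, the set \<open>S\<close> belongs to a
  partition into n tight sets, so the dichotomy applies to it, and closeness rules out a small
  intersection.\<close>

lemma card_Diff_close:
  assumes "part S" "tight T" "close S T"
  shows "real (card (S - T)) \<le> \<epsilon> * (real (card S) + real (card T))"
proof -
  obtain g i where g: "g \<in> carrier G" "i \<in> {1..n}" "S = \<phi> g ` A i"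
    using assms(1) by (auto simp: part_def)
  then show ?thesis
    using Int_or_Diff_small[OF decomposition_image[OF g(1) decomp] _ assms(2) g(2)]
      tight_image[OF g(1) tight_part] assms(3) by (auto simp: close_def)
qed

lemma close_trans:
  assumes "part S" "part T" "part U" "close S T" "close T U"
  shows "close S U"
proof (rule ccontr)
  let ?s = "real (card S)" and ?t = "real (card T)" and ?u = "real (card U)"
  assume "\<not> close S U"
  then have SU: "real (card (S \<inter> U)) \<le> \<epsilon> * (?s + ?u)" by (simp add: close_def)
  have fin: "finite S" "finite T" "finite U"
    using assms part_tight tight_sub finite_sub by blast+
  have cover: "real (card X) \<le> real (card Y) + real (card Z) + real (card W)"
    if "X \<subseteq> Y \<union> Z \<union> W" "finite Y" "finite Z" "finite W" for X Y Z W :: "'a set"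
  proof -
    have "card X \<le> card (Y \<union> Z \<union> W)" using that by (intro card_mono) auto
    then show ?thesis using card_Un_le[of "Y \<union> Z" W] card_Un_le[of Y Z] by linarith
  qed
  note diff = card_Diff_close[OF _ part_tight]
  have ST: "real (card (S - T)) \<le> \<epsilon> * (?s + ?t)" "real (card (T - S)) \<le> \<epsilon> * (?s + ?t)"
    and TU: "real (card (T - U)) \<le> \<epsilon> * (?t + ?u)" "real (card (U - T)) \<le> \<epsilon> * (?t + ?u)"
    using diff[of S T] diff[of T S] diff[of T U] diff[of U T] assms close_sym
    by (simp_all add: add.commute)
  \<comment> \<open>If \<open>S\<close> and \<open>U\<close> were not close, each of the three sets would be covered by three small pieces.\<close>
  have "?s \<le> real (card (S - T)) + real (card (T - U)) + real (card (S \<inter> U))"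
    "?t \<le> real (card (T - S)) + real (card (T - U)) + real (card (S \<inter> U))"
    "?u \<le> real (card (U - T)) + real (card (T - S)) + real (card (S \<inter> U))"
    using fin by (intro cover; blast)+
  \<comment> \<open>Among the nine pieces on the right, three come from each of the pairs S,T and
    T,U and three are the intersection of S and U. Each pair thus contributes
    3\<open>\<epsilon>\<close> times its two sizes, and every size occurs in two pairs.\<close>
  then have "?s + ?t + ?u \<le> 6 * \<epsilon> * (?s + ?t + ?u)"
    using ST TU SU by (simp add: algebra_simps)
  moreover have "6 * \<epsilon> * (?s + ?t + ?u) < 1 * (?s + ?t + ?u)"
    using six_eps_less tight_card_pos[OF part_tight[OF assms(1)]]
    by (intro mult_strict_right_mono) auto
  ultimately show False unfolding mult_1 using leD by blast
qed

text \<open>Distinct parts of one translate are disjoint. Together with transitivity of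
  \<open>close\<close>, this makes the matching of a translate with \<open>A\<close> unique.\<close>

lemma close_same_image:
  assumes "g \<in> carrier G" "i \<in> {1..n}" "j \<in> {1..n}" "close (\<phi> g ` A i) (\<phi> g ` A j)"
  shows "i = j"
proof (rule ccontr)
  assume "i \<noteq> j"
  then have "\<phi> g ` A i \<inter> \<phi> g ` A j = {}"
    using decomposition_disjoint[OF decomposition_image[OF assms(1) decomp]] assms by blast
  moreover have "0 \<le> \<epsilon> * (real (card (\<phi> g ` A i)) + real (card (\<phi> g ` A j)))"
    using eps_nonneg by simp
  ultimately show False using assms(4) by (simp add: close_def)
qed

text \<open>Cut \<open>A i\<close> out of the parts of gA: some gA_j loses all but a small piece. By
  \<open>two_eps_card_less\<close> that piece is less than half of gA_j, and what lies in
  \<open>A i\<close> exceeds the threshold for closeness.\<close>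

lemma ex_close:
  assumes g: "g \<in> carrier G" and i: "i \<in> {1..n}"
  shows "\<exists>j\<in>{1..n}. close (A i) (\<phi> g ` A j)"
proof -
  obtain j where j: "j \<in> {1..n}"
    and d: "real (card (\<phi> g ` A j - A i)) \<le> \<epsilon> * (real (card (\<phi> g ` A j)) + real (card (A i)))"
    using ex_Diff_small[OF decomposition_image[OF g decomp] _ tight_part[OF i]]
      tight_image[OF g tight_part] by blast
  have c: "card (\<phi> g ` A j) = card (A j)" using card_image_eq[OF g part_sub[OF j]] .
  have "real (card (A j)) = real (card (\<phi> g ` A j - A i)) + real (card (A i \<inter> \<phi> g ` A j))"
    using card_Diff_subset_Int[of "\<phi> g ` A j" "A i"] c finite_sub[OF image_sub[OF g part_sub[OF j]]]
      card_mono[of "\<phi> g ` A j" "\<phi> g ` A j \<inter> A i"] by (simp add: Int_commute)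
  moreover note two_eps_card_less[OF j i] d
  ultimately have "close (A i) (\<phi> g ` A j)"
    unfolding close_def c by (simp add: algebra_simps)
  then show ?thesis using j by blast
qed

text \<open>If two parts of \<open>A\<close> were close to the same translate, they would be close
  to each other, hence equal by \<open>close_same_image\<close> for the identity. An injective
  choice on a finite index set is a permutation.\<close>

lemma ex_matching:
  assumes g: "g \<in> carrier G"
  shows "\<exists>\<sigma>. \<sigma> permutes {1..n} \<and> (\<forall>i\<in>{1..n}. close (A i) (\<phi> g ` A (\<sigma> i)))"
proof -
  obtain f where f: "\<And>i. i \<in> {1..n} \<Longrightarrow> f i \<in> {1..n} \<and> close (A i) (\<phi> g ` A (f i))"
    using ex_close[OF g] by metis
  \<comment> \<open>The value outside the index range is the identity because
    \<open>permutes\<close> demands it.\<close>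
  define \<sigma> where "\<sigma> i = (if i \<in> {1..n} then f i else i)" for i
  have "inj_on \<sigma> {1..n}"
  proof (rule inj_onI)
    fix i j assume ij: "i \<in> {1..n}" "j \<in> {1..n}" "\<sigma> i = \<sigma> j"
    then have eq: "f i = f j" by (simp add: \<sigma>_def)
    have "close (A i) (A j)"
      using close_trans[OF part_A part_image part_A] f[OF ij(1)] f[OF ij(2)] eq ij g close_sym
      by metis
    then show "i = j"
      using close_same_image[OF one_closed ij(1,2)] image_one part_sub ij by simp
  qed
  moreover have "\<sigma> ` {1..n} \<subseteq> {1..n}" using f by (auto simp: \<sigma>_def)
  ultimately have "bij_betw \<sigma> {1..n} {1..n}"
    by (simp add: bij_betw_def endo_inj_surj)
  then have "\<sigma> permutes {1..n}" by (rule bij_imp_permutes) (auto simp: \<sigma>_def)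
  moreover have "close (A i) (\<phi> g ` A (\<sigma> i))" if "i \<in> {1..n}" for i
    using f[OF that] that by (simp add: \<sigma>_def)
  ultimately show ?thesis by blast
qed

text \<open>The intersections are too large to have ratio at least \<open>b\<close>, so the
  remainder has it. Its boundary is contained in the union of the boundaries of the intersections,
  whose sizes add up to at most \<open>2 * a * card V\<close> because both families partition
  \<open>V\<close>.\<close>

lemma card_unmatched_le:
  assumes D: "decomposition V n D" "\<And>i. i \<in> {1..n} \<Longrightarrow> part (D i)"
    and close: "\<And>i. i \<in> {1..n} \<Longrightarrow> close (A i) (D i)"
  shows "real (card (V - (\<Union>i\<in>{1..n}. A i \<inter> D i))) \<le> 2 * \<epsilon> * real (card V)"
proof -
  let ?C = "\<lambda>i. A i \<inter> D i" and ?R = "V - (\<Union>i\<in>{1..n}. A i \<inter> D i)"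
  have tight: "tight (A i)" "tight (D i)" if "i \<in> {1..n}" for i
    using that tight_part part_tight D(2) by blast+
  have sub: "?C i \<subseteq> V" if "i \<in> {1..n}" for i using part_sub[OF that] by blast
  have bdC: "real (card (bd (?C i))) \<le> a * (real (card (A i)) + real (card (D i)))"
    if i: "i \<in> {1..n}" for i
    using card_bd_le_sum[OF bd_Int[OF tight_sub tight_sub] tight[OF i]] tight[OF i] .
  have "\<exists>X\<in>insert ?R (?C ` {1..n}). b * real (card X) \<le> real (card (bd X))"
  proof (rule wide_family)
    show "disjoint_family_on ?C {1..n}"
      unfolding disjoint_family_on_def using decomposition_disjoint[OF decomp] by blast
  qed (use sub in blast)
  moreover have "\<not> b * real (card (?C i)) \<le> real (card (bd (?C i)))" if i: "i \<in> {1..n}" for i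
  proof
    assume "b * real (card (?C i)) \<le> real (card (bd (?C i)))"
    from card_le_eps[OF this bdC[OF i]] show False using close[OF i] by (simp add: close_def)
  qed
  ultimately have R: "b * real (card ?R) \<le> real (card (bd ?R))" by blast
  have "bd ?R \<subseteq> bd (\<Union>i\<in>{1..n}. ?C i)" using sub by (intro bd_compl) blast
  also have "\<dots> \<subseteq> (\<Union>i\<in>{1..n}. bd (?C i))" using sub by (intro bd_UN) auto
  finally have "card (bd ?R) \<le> card (\<Union>i\<in>{1..n}. bd (?C i))"
    using sub finite_bd by (intro card_mono) auto
  also have "\<dots> \<le> (\<Sum>i\<in>{1..n}. card (bd (?C i)))" by (intro card_UN_le) simp
  finally have "real (card (bd ?R)) \<le> (\<Sum>i\<in>{1..n}. real (card (bd (?C i))))"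
    by (simp flip: of_nat_sum)
  also have "\<dots> \<le> (\<Sum>i\<in>{1..n}. a * (real (card (A i)) + real (card (D i))))"
    by (intro sum_mono bdC)
  also have "\<dots> = a * (real (\<Sum>i\<in>{1..n}. card (A i)) + real (\<Sum>i\<in>{1..n}. card (D i)))"
    unfolding of_nat_sum sum_distrib_left[symmetric] sum.distrib ..
  also have "\<dots> = a * (2 * real (card V))"
    using decomposition_sum_card[OF finite_V decomp] decomposition_sum_card[OF finite_V D(1)] by simp
  finally have "real (card ?R) \<le> \<epsilon> * (2 * real (card V))" using card_le_eps[OF R] by blast
  then show ?thesis by simp
qed

section \<open>The imprimitivity system\<close>

theorem ex_imprimitivity_near:
  "\<exists>P. system_of_imprimitivity G V \<phi> n P \<and>
    (\<forall>i\<in>{1..n}. real (card (sym_diff (P i) (A i))) \<le> 4 * a / b * real (card V))"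
proof -
  obtain \<tau> where \<tau>: "\<And>g. g \<in> carrier G \<Longrightarrow> \<tau> g permutes {1..n}"
    and \<tau>_close: "\<And>g i. g \<in> carrier G \<Longrightarrow> i \<in> {1..n} \<Longrightarrow> close (A i) (\<phi> g ` A (\<tau> g i))"
    using ex_matching by metis
  \<comment> \<open>\<open>D g\<close> is the translate gA, renumbered so that its i-th part is the
    one close to \<open>A i\<close>.\<close>
  define D where "D g i = \<phi> g ` A (\<tau> g i)" for g i
  have \<tau>_in: "\<tau> g i \<in> {1..n}" if "g \<in> carrier G" "i \<in> {1..n}" for g i
    using permutes_in_image[OF \<tau>[OF that(1)]] that(2) by blast
  have D_part: "part (D g i)" and D_sub: "D g i \<subseteq> V" and D_card: "card (D g i) = card (A (\<tau> g i))"
    and D_close: "close (A i) (D g i)"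
    if "g \<in> carrier G" "i \<in> {1..n}" for g i
    using part_image[OF that(1) \<tau>_in[OF that]] image_sub[OF that(1) part_sub[OF \<tau>_in[OF that]]]
      card_image_eq[OF that(1) part_sub[OF \<tau>_in[OF that]]] \<tau>_close[OF that]
    by (auto simp: D_def)
  have D_decomp: "decomposition V n (D g)" if g: "g \<in> carrier G" for g
  proof -
    have "bij_betw (\<tau> g) {1..n} {1..n}" using \<tau>[OF g] by (rule permutes_imp_bij)
    then have im: "\<tau> g ` {1..n} = {1..n}" and inj: "inj_on (\<tau> g) {1..n}"
      by (auto simp: bij_betw_def)
    note dg = decomposition_image[OF g decomp]
    have "(\<Union>i\<in>{1..n}. D g i) = (\<Union>j\<in>\<tau> g ` {1..n}. \<phi> g ` A j)" by (simp add: D_def)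
    also have "\<dots> = V" unfolding im using dg by (simp add: decomposition_def)
    finally have "(\<Union>i\<in>{1..n}. D g i) = V" .
    moreover have "D g i \<noteq> {}" if "i \<in> {1..n}" for i
      using decomposition_part(2)[OF dg \<tau>_in[OF g that]] by (simp add: D_def)
    moreover have "D g i \<inter> D g j = {}" if "i \<in> {1..n}" "j \<in> {1..n}" "i \<noteq> j" for i j
      using decomposition_disjoint[OF dg \<tau>_in[OF g that(1)] \<tau>_in[OF g that(2)]]
        inj_onD[OF inj] that by (auto simp: D_def)
    ultimately show ?thesis by (simp add: decomposition_def disjoint_family_on_def)
  qed
  \<comment> \<open>Applying k to the closeness of \<open>A (\<tau> k i)\<close> and
    \<open>D g (\<tau> k i)\<close> shows that the right-hand side is close to \<open>D k i\<close>,
    hence to \<open>A i\<close>. It is a part of the translate by \<open>k \<otimes> g\<close>, so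
    it is the matched one by uniqueness.\<close>
  have D_mult: "D (k \<otimes> g) i = \<phi> k ` D g (\<tau> k i)"
    if k: "k \<in> carrier G" and g: "g \<in> carrier G" and i: "i \<in> {1..n}" for k g i
  proof -
    have kg: "k \<otimes> g \<in> carrier G" using k g by simp
    have ki: "\<tau> k i \<in> {1..n}" using \<tau>_in k i by blast
    have eq: "\<phi> k ` D g (\<tau> k i) = \<phi> (k \<otimes> g) ` A (\<tau> g (\<tau> k i))"
      unfolding D_def using image_mult[OF k g part_sub[OF \<tau>_in[OF g ki]]] by simp
    have "close (D k i) (\<phi> k ` D g (\<tau> k i))"
      unfolding D_def[of k] using close_image[OF k part_sub[OF ki] D_sub[OF g ki] D_close[OF g ki]] .
    then have "close (A i) (\<phi> k ` D g (\<tau> k i))"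
      using close_trans[OF part_A[OF i] D_part[OF k i] _ D_close[OF k i]] eq
        part_image[OF kg \<tau>_in[OF g ki]] by metis
    then have "close (D (k \<otimes> g) i) (\<phi> k ` D g (\<tau> k i))"
      using close_trans[OF D_part[OF kg i] part_A[OF i]] D_close[OF kg i] close_sym eq
        part_image[OF kg \<tau>_in[OF g ki]] by metis
    then have "\<tau> (k \<otimes> g) i = \<tau> g (\<tau> k i)"
      using close_same_image[OF kg \<tau>_in[OF kg i] \<tau>_in[OF g ki]] eq by (simp add: D_def)
    then show ?thesis using eq by (simp add: D_def)
  qed
  let ?G = "card (carrier G)"
  define cnt where "cnt v i = card {g \<in> carrier G. v \<in> D g i}" for v i
  define P where "P i = {v \<in> V. ?G < 2 * cnt v i}" for i
  \<comment> \<open>Replacing g by \<open>k \<otimes> g\<close> does not change the count, and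
    \<open>D_mult\<close> then moves k from the vertex to the index.\<close>
  have cnt: "cnt (\<phi> k v) i = cnt v (\<tau> k i)"
    if k: "k \<in> carrier G" and v: "v \<in> V" and i: "i \<in> {1..n}" for k v i
  proof -
    have "cnt (\<phi> k v) i = card {g \<in> carrier G. \<phi> k v \<in> D (k \<otimes> g) i}"
      unfolding cnt_def by (rule card_translate[OF k, symmetric])
    also have "{g \<in> carrier G. \<phi> k v \<in> D (k \<otimes> g) i} = {g \<in> carrier G. v \<in> D g (\<tau> k i)}"
      using D_mult[OF k _ i] mem_image_iff[OF k D_sub[OF _ \<tau>_in[OF k i]] v] by auto
    finally show ?thesis by (simp add: cnt_def)
  qed
  have P_image: "\<phi> k ` P (\<tau> k i) = P i" if k: "k \<in> carrier G" and i: "i \<in> {1..n}" for k i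
  proof -
    have "\<phi> k ` P (\<tau> k i) = {w \<in> \<phi> k ` V. ?G < 2 * cnt w i}"
      using cnt[OF k _ i] by (auto simp: P_def)
    then show ?thesis using surj_prop[OF k] by (simp add: P_def)
  qed
  \<comment> \<open>Non-membership is written as membership in \<open>- D g i\<close>, the form that
    \<open>sum_card_incidence\<close> counts.\<close>
  have cnt_compl: "cnt v i + card {g \<in> carrier G. v \<in> - D g i} = ?G" for v i
  proof -
    have "card ({g \<in> carrier G. v \<in> D g i} \<union> {g \<in> carrier G. v \<in> - D g i})
        = card {g \<in> carrier G. v \<in> D g i} + card {g \<in> carrier G. v \<in> - D g i}"
      using finite_G by (intro card_Un_disjoint) auto
    moreover have "{g \<in> carrier G. v \<in> D g i} \<union> {g \<in> carrier G. v \<in> - D g i} = carrier G" by blast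
    ultimately show ?thesis by (simp add: cnt_def)
  qed
  \<comment> \<open>Otherwise every vertex of \<open>A i\<close> would be missed by at least half of
    the sets \<open>D g i\<close>. On average these would miss at least half of \<open>A i\<close>,
    while each of them misses less than half.\<close>
  have P_ne: "P i \<noteq> {}" if i: "i \<in> {1..n}" for i
  proof
    assume "P i = {}"
    then have low: "2 * cnt v i \<le> ?G" if "v \<in> V" for v
      using that by (auto simp: P_def not_less)
    have "real ?G * real (card (A i)) = (\<Sum>v\<in>A i. real ?G)" by simp
    also have "\<dots> \<le> (\<Sum>v\<in>A i. 2 * real (card {g \<in> carrier G. v \<in> - D g i}))"
    proof (rule sum_mono)
      fix v assume "v \<in> A i"
      then have "2 * cnt v i \<le> ?G" using low part_sub[OF i] by blast
      then show "real ?G \<le> 2 * real (card {g \<in> carrier G. v \<in> - D g i})"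
        using cnt_compl[of v i] by linarith
    qed
    also have "\<dots> = 2 * real (\<Sum>g\<in>carrier G. card (A i \<inter> - D g i))"
      using sum_card_incidence[OF finite_sub[OF part_sub[OF i]] finite_G, of "\<lambda>g. - D g i"]
      by (simp flip: sum_distrib_left of_nat_sum)
    also have "\<dots> = (\<Sum>g\<in>carrier G. 2 * real (card (A i - D g i)))"
      by (simp add: sum_distrib_left Diff_eq)
    also have "\<dots> < (\<Sum>g\<in>carrier G. real (card (A i)))"
    proof (rule sum_strict_mono[OF finite_G])
      fix g assume g: "g \<in> carrier G"
      show "2 * real (card (A i - D g i)) < real (card (A i))"
        using card_Diff_close[OF part_A[OF i] part_tight[OF D_part[OF g i]] D_close[OF g i]]
          two_eps_card_less[OF i \<tau>_in[OF g i]] D_card[OF g i] by simp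
    qed (use one_closed in blast)
    finally show False by simp
  qed
  \<comment> \<open>Two strict majorities of the group have a common element g, and
    \<open>D g i\<close> and \<open>D g j\<close> are disjoint.\<close>
  have P_disj: "P i \<inter> P j = {}" if ij: "i \<in> {1..n}" "j \<in> {1..n}" "i \<noteq> j" for i j
  proof (rule ccontr)
    assume "P i \<inter> P j \<noteq> {}"
    then obtain v where v: "?G < 2 * cnt v i" "?G < 2 * cnt v j" by (auto simp: P_def)
    have "{g \<in> carrier G. v \<in> D g i} \<subseteq> {g \<in> carrier G. v \<in> - D g j}"
      using decomposition_disjoint[OF D_decomp] ij by blast
    then have "cnt v i \<le> card {g \<in> carrier G. v \<in> - D g j}"
      unfolding cnt_def using finite_G by (intro card_mono) auto
    then show False using v cnt_compl[of v j] by linarith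
  qed
  \<comment> \<open>A vertex need not have a majority index a priori. Transitivity supplies one:
    carry the vertex into the non-empty block \<open>P 1\<close> and read off its own block by
    equivariance of \<open>cnt\<close>.\<close>
  have P_cover: "(\<Union>i\<in>{1..n}. P i) = V"
  proof
    show "(\<Union>i\<in>{1..n}. P i) \<subseteq> V" by (auto simp: P_def)
    show "V \<subseteq> (\<Union>i\<in>{1..n}. P i)"
    proof
      fix u assume u: "u \<in> V"
      have 1: "1 \<in> {1..n}" using two_le_n by simp
      then obtain v where v: "v \<in> P 1" using P_ne by blast
      then have "v \<in> V" by (simp add: P_def)
      then obtain k where k: "k \<in> carrier G" "\<phi> k u = v" using unique_orbit u by blast
      then have "?G < 2 * cnt u (\<tau> k 1)" using v cnt[OF k(1) u 1] by (simp add: P_def)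
      then show "u \<in> (\<Union>i\<in>{1..n}. P i)" using u \<tau>_in[OF k(1) 1] by (auto simp: P_def)
    qed
  qed
  have "decomposition V n P"
    using P_ne P_disj P_cover by (simp add: decomposition_def disjoint_family_on_def)
  moreover have "\<exists>\<sigma>. \<sigma> permutes {1..n} \<and> (\<forall>i\<in>{1..n}. \<phi> g ` P i = P (\<sigma> i))"
    if g: "g \<in> carrier G" for g
  proof (intro exI conjI ballI)
    \<comment> \<open>The inverse appears because \<open>P_image\<close> says that g carries the
      block with index \<open>\<tau> g i\<close> to the one with index i.\<close>
    show p: "inv_into UNIV (\<tau> g) permutes {1..n}" using \<tau>[OF g] by (rule permutes_inv)
    fix i assume "i \<in> {1..n}"
    then have "inv_into UNIV (\<tau> g) i \<in> {1..n}" using permutes_in_image[OF p] by blast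
    from P_image[OF g this] show "\<phi> g ` P i = P (inv_into UNIV (\<tau> g) i)"
      using permutes_inverses(1)[OF \<tau>[OF g]] by simp
  qed
  moreover have "real (card (sym_diff (P i) (A i))) \<le> 4 * a / b * real (card V)"
    if i: "i \<in> {1..n}" for i
  proof -
    let ?S = "sym_diff (P i) (A i)"
    have S_sub: "?S \<subseteq> V" using part_sub[OF i] by (auto simp: P_def)
    have "real ?G * real (card ?S) = (\<Sum>v\<in>?S. real ?G)" by simp
    \<comment> \<open>A vertex on which \<open>P i\<close> and \<open>A i\<close> disagree is one on
      which \<open>A i\<close> disagrees with \<open>D g i\<close> for at least half of all g. This
      costs a factor 2, and the bound on unmatched vertices another 2, whence the constant
      4.\<close>
    also have "\<dots> \<le> (\<Sum>v\<in>?S. 2 * real (card {g \<in> carrier G. v \<in> sym_diff (A i) (D g i)}))"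
    proof (rule sum_mono)
      fix v assume v: "v \<in> ?S"
      show "real ?G \<le> 2 * real (card {g \<in> carrier G. v \<in> sym_diff (A i) (D g i)})"
      proof (cases "v \<in> A i")
        case True
        then have "2 * cnt v i \<le> ?G" using v part_sub[OF i] by (auto simp: P_def)
        moreover have "{g \<in> carrier G. v \<in> sym_diff (A i) (D g i)} = {g \<in> carrier G. v \<in> - D g i}"
          using True by blast
        ultimately show ?thesis using cnt_compl[of v i] by simp
      next
        case False
        then have "?G < 2 * cnt v i" using v by (auto simp: P_def)
        moreover have "{g \<in> carrier G. v \<in> sym_diff (A i) (D g i)} = {g \<in> carrier G. v \<in> D g i}"
          using False by blast
        ultimately show ?thesis by (simp add: cnt_def)
      qed
    qed
    also have "\<dots> = 2 * real (\<Sum>g\<in>carrier G. card (?S \<inter> sym_diff (A i) (D g i)))"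
      using sum_card_incidence[OF finite_sub[OF S_sub] finite_G, of "\<lambda>g. sym_diff (A i) (D g i)"]
      by (simp flip: sum_distrib_left of_nat_sum)
    also have "\<dots> = (\<Sum>g\<in>carrier G. 2 * real (card (?S \<inter> sym_diff (A i) (D g i))))"
      by (simp add: sum_distrib_left)
    also have "\<dots> \<le> (\<Sum>g\<in>carrier G. 4 * \<epsilon> * real (card V))"
    proof (rule sum_mono)
      fix g assume g: "g \<in> carrier G"
      let ?R = "V - (\<Union>j\<in>{1..n}. A j \<inter> D g j)"
      \<comment> \<open>A vertex in just one of the two i-th sets cannot be matched at i, nor at
        another index, since the sets there are disjoint from both the respective i-th sets.\<close>
      have "sym_diff (A i) (D g i) \<subseteq> ?R"
      proof
        fix v assume v: "v \<in> sym_diff (A i) (D g i)"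
        have "v \<notin> A j \<inter> D g j" if "j \<in> {1..n}" for j
          using v i that decomposition_disjoint[OF decomp i that]
            decomposition_disjoint[OF D_decomp[OF g] i that] by (cases "i = j") auto
        then show "v \<in> ?R" using v part_sub[OF i] D_sub[OF g i] by blast
      qed
      then have "card (?S \<inter> sym_diff (A i) (D g i)) \<le> card ?R"
        using finite_V by (intro card_mono) auto
      then show "2 * real (card (?S \<inter> sym_diff (A i) (D g i))) \<le> 4 * \<epsilon> * real (card V)"
        using card_unmatched_le[OF D_decomp[OF g] D_part[OF g] D_close[OF g]] by linarith
    qed
    also have "\<dots> = real ?G * (4 * \<epsilon> * real (card V))" by simp
    finally have "real (card ?S) \<le> 4 * \<epsilon> * real (card V)"
      using card_carrier_pos by (simp only: mult_le_cancel_left_pos of_nat_0_less_iff)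
    then show ?thesis by (simp add: \<epsilon>_def)
  qed
  ultimately show ?thesis unfolding system_of_imprimitivity_def by blast
qed

end

section \<open>Edge and vertex boundaries of graphs\<close>

lemma finite_carrier_aut_group:
  assumes "finite V"
  shows "finite (carrier (aut_group V E))"
proof (rule finite_subset)
  show "carrier (aut_group V E) \<subseteq> V \<rightarrow>\<^sub>E V"
    by (auto simp: aut_group_def Bij_def bij_betw_def PiE_def)
  show "finite (V \<rightarrow>\<^sub>E V)" using assms by (simp add: finite_PiE)
qed

lemma edges_between_commute: "edges_between E A B = edges_between E B A"
  unfolding edges_between_def by (metis insert_commute)

lemma (in simple_graph) edge_boundary_operator: "boundary_operator V (edge_boundary V E)"
proof
  show "finite V" by (rule finite_V)
  have "finite E"
    by (rule finite_subset[of _ "Pow V"]) (use edges finite_V in auto)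
  then show "finite (edge_boundary V E X)" for X
    by (simp add: edge_boundary_def edges_between_def)
  show "edge_boundary V E {} = {}" by (simp add: edge_boundary_def edges_between_def)
  show "edge_boundary V E (X \<union> Y) \<subseteq> edge_boundary V E X \<union> edge_boundary V E Y" for X Y
    unfolding edge_boundary_def edges_between_def by blast
  show "edge_boundary V E (V - X) \<subseteq> edge_boundary V E X" if "X \<subseteq> V" for X
    using that edges_between_commute[of E X "V - X"] by (simp add: edge_boundary_def double_diff)
qed

text \<open>Since the vertex boundary is two-sided, it consists of all endpoints of boundary edges.
  Subadditivity, symmetry under complement and invariance therefore pass from edges to
  vertices.\<close>

lemma vertex_boundary_eq:
  assumes "X \<subseteq> V"
  shows "vertex_boundary V E X = V \<inter> \<Union> (edge_boundary V E X)"
  unfolding vertex_boundary_def vertices_between_def edge_boundary_def[symmetric]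
  using assms by blast

lemma (in simple_graph) vertex_boundary_operator: "boundary_operator V (vertex_boundary V E)"
proof -
  interpret edge: boundary_operator V "edge_boundary V E" by (rule edge_boundary_operator)
  show ?thesis
  proof
    fix X assume X: "X \<subseteq> V"
    show "finite (vertex_boundary V E X)" using finite_V by (simp add: vertex_boundary_eq[OF X])
    show "vertex_boundary V E (V - X) \<subseteq> vertex_boundary V E X"
      unfolding vertex_boundary_eq[OF X] vertex_boundary_eq[OF Diff_subset]
      using edge.bd_compl[OF X] by blast
    fix Y assume Y: "Y \<subseteq> V"
    show "vertex_boundary V E (X \<union> Y) \<subseteq> vertex_boundary V E X \<union> vertex_boundary V E Y"
      unfolding vertex_boundary_eq[OF X] vertex_boundary_eq[OF Y] vertex_boundary_eq[OF Un_least[OF X Y]]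
      using edge.bd_Un[OF X Y] by blast
  qed (simp_all add: finite_V vertex_boundary_eq edge.bd_empty)
qed

lemma aut_group_edge_iff:
  assumes "f \<in> carrier (aut_group V E)" "u \<in> V" "v \<in> V"
  shows "{f u, f v} \<in> E \<longleftrightarrow> {u, v} \<in> E"
  using assms by (simp add: aut_group_def)

lemma aut_group_image:
  assumes "f \<in> carrier (aut_group V E)"
  shows "f ` V = V" "inj_on f V"
  using assms by (auto simp: aut_group_def Bij_def bij_betw_def)

text \<open>A boundary edge of the image is pulled back along f, which is onto \<open>V\<close> and
  reflects edges. This inclusion yields the comparison of cardinalities required by
  \<open>card_bd_image\<close>.\<close>

lemma edge_boundary_image:
  assumes f: "f \<in> carrier (aut_group V E)" and X: "X \<subseteq> V"
  shows "edge_boundary V E (f ` X) \<subseteq> (`) f ` edge_boundary V E X"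
proof
  fix e assume "e \<in> edge_boundary V E (f ` X)"
  then obtain x y where xy: "e \<in> E" "e = {f x, y}" "x \<in> X" "y \<in> V - f ` X"
    by (auto simp: edge_boundary_def edges_between_def)
  then obtain z where z: "z \<in> V - X" "y = f z" using aut_group_image(1)[OF f] by blast
  then have "{x, z} \<in> E" using xy aut_group_edge_iff[OF f, of x z] X by blast
  then have "{x, z} \<in> edge_boundary V E X"
    using xy z by (auto simp: edge_boundary_def edges_between_def)
  moreover have "e = f ` {x, z}" using xy z by simp
  ultimately show "e \<in> (`) f ` edge_boundary V E X" by blast
qed

lemma vertex_boundary_image:
  assumes f: "f \<in> carrier (aut_group V E)" and X: "X \<subseteq> V"
  shows "vertex_boundary V E (f ` X) \<subseteq> f ` vertex_boundary V E X"
proof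
  have fX: "f ` X \<subseteq> V" using aut_group_image(1)[OF f] X by blast
  fix v assume "v \<in> vertex_boundary V E (f ` X)"
  then obtain e where e: "e \<in> edge_boundary V E X" "v \<in> f ` e"
    using edge_boundary_image[OF f X] by (auto simp: vertex_boundary_eq[OF fX])
  moreover have "e \<subseteq> V" using e(1) X by (auto simp: edge_boundary_def edges_between_def)
  ultimately show "v \<in> f ` vertex_boundary V E X" by (auto simp: vertex_boundary_eq[OF X])
qed

text \<open>The averaging takes place in the full automorphism group, which is finite. Blocks for it
  are blocks for every group acting through it, so \<open>G\<close> itself may be infinite.\<close>

lemma system_of_imprimitivity_aut_group:
  assumes "system_of_imprimitivity (aut_group V E) V (\<lambda>f. f) n P" "acts_by_automorphisms G V E \<phi>"
  shows "system_of_imprimitivity G V \<phi> n P"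
  using assms by (simp add: system_of_imprimitivity_def acts_by_automorphisms_def)

section \<open>From ratio bounds to the minima h and iota\<close>

lemma max_ratio_ge:
  assumes "i \<in> {1..n}"
  shows "real (card (bd (A i))) / real (card (A i)) \<le> max_ratio bd n A"
  unfolding max_ratio_def using assms by (intro Max_ge) auto

lemma max_ratio_attained:
  assumes "1 \<le> n"
  shows "\<exists>i\<in>{1..n}. max_ratio bd n A = real (card (bd (A i))) / real (card (A i))"
proof -
  have "max_ratio bd n A \<in> (\<lambda>i. real (card (bd (A i))) / real (card (A i))) ` {1..n}"
    unfolding max_ratio_def using assms by (intro Max_in) auto
  then show ?thesis by blast
qed

text \<open>The function \<open>m\<close> stands for h or iota, with \<open>bd\<close> the boundary
  that goes with it, so that both halves of the theorem are instances.\<close>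

lemma aut_group_imprimitivity:
  fixes bd :: "'a set \<Rightarrow> 'b set" and m :: "nat \<Rightarrow> real"
  assumes bop: "boundary_operator V bd"
    and trans: "vertex_transitive V E"
    and bd_image: "\<And>f X. f \<in> carrier (aut_group V E) \<Longrightarrow> X \<subseteq> V \<Longrightarrow> card (bd (f ` X)) \<le> card (bd X)"
    and m: "\<And>k. m k = Min {max_ratio bd k A | A. decomposition V k A}"
    and n: "2 \<le> n"
    and gap: "real (2 * (n + 1)) * m n < m (n + 1)"
    and A: "decomposition V n A" "max_ratio bd n A = m n"
  shows "\<exists>P. system_of_imprimitivity (aut_group V E) V (\<lambda>f. f) n P
    \<and> (\<forall>i\<in>{1..n}. real (card (sym_diff (P i) (A i))) \<le> 4 * m n / m (n + 1) * real (card V))"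
proof -
  interpret boundary_operator V bd by fact
  have pos: "0 < card (B i)" if "decomposition V k B" "i \<in> {1..k}" for B k i
    using decomposition_part[OF that] finite_V by (auto simp: card_gt_0_iff intro: finite_subset)
  interpret ratio_gap "aut_group V E" V "\<lambda>f. f" bd A n "m n" "m (n + 1)"
  proof (intro ratio_gap.intro ratio_gap_axioms.intro bop)
    show "transitive_action (aut_group V E) V (\<lambda>f. f)"
      using trans by (simp add: vertex_transitive_def)
    show "finite (carrier (aut_group V E))" by (rule finite_carrier_aut_group[OF finite_V])
    show "real (card (bd (A i))) \<le> m n * real (card (A i))" if "i \<in> {1..n}" for i
      using max_ratio_ge[OF that, of bd A] A(2) pos[OF A(1) that] by (simp add: field_simps)
    show "2 * (real n + 1) * m n < m (n + 1)" using gap by (simp add: algebra_simps)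
    show "\<exists>i\<in>{1..n + 1}. m (n + 1) * real (card (B i)) \<le> real (card (bd (B i)))"
      if B: "decomposition V (n + 1) B" for B
    proof -
      obtain i where i: "i \<in> {1..n + 1}"
        "max_ratio bd (n + 1) B = real (card (bd (B i))) / real (card (B i))"
        using max_ratio_attained[of "n + 1" bd B] by auto
      \<comment> \<open>The index at which \<open>B\<close> attains its largest ratio witnesses
        \<open>wide\<close>, because that ratio is at least the minimum over all partitions.\<close>
      have "m (n + 1) \<le> max_ratio bd (n + 1) B"
        unfolding m using B by (intro Min_le finite_max_ratios[OF finite_V]) blast
      then have "m (n + 1) * real (card (B i)) \<le> real (card (bd (B i)))"
        unfolding i(2) using pos[OF B i(1)] by (simp add: field_simps)
      then show ?thesis using i(1) by blast
    qed
  qed (use n A bd_image in auto)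
  show ?thesis by (rule ex_imprimitivity_near)
qed

text \<open>The conclusion has the shape of one half of the theorem with \<open>achieves_h\<close>
  or \<open>achieves_iota\<close> unfolded. The statement about \<open>G\<close> follows by
  contradiction: a gap would give blocks for the automorphism group, hence for
  \<open>G\<close>.\<close>

lemma aut_group_imprimitivity_achieving:
  fixes bd :: "'a set \<Rightarrow> 'b set" and m :: "nat \<Rightarrow> real"
  assumes "boundary_operator V bd"
    and "vertex_transitive V E"
    and "\<And>f X. f \<in> carrier (aut_group V E) \<Longrightarrow> X \<subseteq> V \<Longrightarrow> card (bd (f ` X)) \<le> card (bd X)"
    and m: "\<And>k. m k = Min {max_ratio bd k A | A. decomposition V k A}"
    and n: "2 \<le> n" "n \<le> card V - 1"
  shows "(real (2 * (n + 1)) * m n < m (n + 1) \<longrightarrow>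
       (\<exists>P A. system_of_imprimitivity (aut_group V E) V (\<lambda>f. f) n P
            \<and> (decomposition V n A \<and> max_ratio bd n A = m n)
            \<and> (\<forall>i\<in>{1..n}. real (card (sym_diff (P i) (A i))) \<le> 4 * m n / m (n + 1) * real (card V))))
     \<and> (real (2 * (n + 1)) * m n < m (n + 1) \<longrightarrow>
       (\<forall>A. decomposition V n A \<and> max_ratio bd n A = m n \<longrightarrow>
          (\<exists>P. system_of_imprimitivity (aut_group V E) V (\<lambda>f. f) n P
            \<and> (\<forall>i\<in>{1..n}. real (card (sym_diff (P i) (A i))) \<le> 4 * m n / m (n + 1) * real (card V)))))
     \<and> (\<forall>(G :: ('g, 'm) monoid_scheme) \<phi>.
          acts_by_automorphisms G V E \<phi> \<and> transitive_action G V \<phi>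
          \<and> \<not> (\<exists>P. system_of_imprimitivity G V \<phi> n P) \<longrightarrow>
          m (n + 1) \<le> real (2 * (n + 1)) * m n)"
proof -
  have near: "\<exists>P. system_of_imprimitivity (aut_group V E) V (\<lambda>f. f) n P
      \<and> (\<forall>i\<in>{1..n}. real (card (sym_diff (P i) (A i))) \<le> 4 * m n / m (n + 1) * real (card V))"
    if "real (2 * (n + 1)) * m n < m (n + 1)" "decomposition V n A" "max_ratio bd n A = m n" for A
    by (rule aut_group_imprimitivity[OF assms(1,2) _ m n(1) that]) (rule assms(3))
  interpret boundary_operator V bd by fact
  obtain A where A: "decomposition V n A" "max_ratio bd n A = m n"
    using ex_min_max_ratio[OF finite_V, of n bd] n unfolding m by fastforce
  show ?thesis
  proof (intro conjI impI allI)
    assume gap: "real (2 * (n + 1)) * m n < m (n + 1)"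
    show "\<exists>P A. system_of_imprimitivity (aut_group V E) V (\<lambda>f. f) n P
            \<and> (decomposition V n A \<and> max_ratio bd n A = m n)
            \<and> (\<forall>i\<in>{1..n}. real (card (sym_diff (P i) (A i))) \<le> 4 * m n / m (n + 1) * real (card V))"
      using near[OF gap A] A by blast
  next
    fix A assume "real (2 * (n + 1)) * m n < m (n + 1)"
      "decomposition V n A \<and> max_ratio bd n A = m n"
    then show "\<exists>P. system_of_imprimitivity (aut_group V E) V (\<lambda>f. f) n P
            \<and> (\<forall>i\<in>{1..n}. real (card (sym_diff (P i) (A i))) \<le> 4 * m n / m (n + 1) * real (card V))"
      using near by blast
  next
    fix G :: "('g, 'm) monoid_scheme" and \<phi>
    assume G: "acts_by_automorphisms G V E \<phi> \<and> transitive_action G V \<phi>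
      \<and> \<not> (\<exists>P. system_of_imprimitivity G V \<phi> n P)"
    show "m (n + 1) \<le> real (2 * (n + 1)) * m n"
    proof (rule ccontr)
      assume "\<not> ?thesis"
      then have "real (2 * (n + 1)) * m n < m (n + 1)" by simp
      from near[OF this A] show False using system_of_imprimitivity_aut_group G by blast
    qed
  qed
qed

theorem theoremB:
  fixes V :: "'a set" and E :: "'a set set" and n :: nat
  assumes "simple_graph V E"
    and "vertex_transitive V E"
    and "2 \<le> n" and "n \<le> card V - 1"
  shows
    "((real (2 * (n + 1)) * h V E n < h V E (n + 1) \<longrightarrow>
       (\<exists>P A. system_of_imprimitivity (aut_group V E) V (\<lambda>f. f) n P
            \<and> achieves_h V E n A
            \<and> (\<forall>i\<in>{1..n}. real (card (sym_diff (P i) (A i)))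
                  \<le> 4 * h V E n / h V E (n + 1) * real (card V))))
     \<and> (real (2 * (n + 1)) * h V E n < h V E (n + 1) \<longrightarrow>
       (\<forall>A. achieves_h V E n A \<longrightarrow>
          (\<exists>P. system_of_imprimitivity (aut_group V E) V (\<lambda>f. f) n P
            \<and> (\<forall>i\<in>{1..n}. real (card (sym_diff (P i) (A i)))
                  \<le> 4 * h V E n / h V E (n + 1) * real (card V)))))
     \<and> (\<forall>(G :: ('g, 'm) monoid_scheme) \<phi>.
          acts_by_automorphisms G V E \<phi> \<and> transitive_action G V \<phi>
          \<and> \<not> (\<exists>P. system_of_imprimitivity G V \<phi> n P) \<longrightarrow>
          h V E (n + 1) \<le> real (2 * (n + 1)) * h V E n))
     \<and>
     ((real (2 * (n + 1)) * iota V E n < iota V E (n + 1) \<longrightarrow>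
       (\<exists>P A. system_of_imprimitivity (aut_group V E) V (\<lambda>f. f) n P
            \<and> achieves_iota V E n A
            \<and> (\<forall>i\<in>{1..n}. real (card (sym_diff (P i) (A i)))
                  \<le> 4 * iota V E n / iota V E (n + 1) * real (card V))))
     \<and> (real (2 * (n + 1)) * iota V E n < iota V E (n + 1) \<longrightarrow>
       (\<forall>A. achieves_iota V E n A \<longrightarrow>
          (\<exists>P. system_of_imprimitivity (aut_group V E) V (\<lambda>f. f) n P
            \<and> (\<forall>i\<in>{1..n}. real (card (sym_diff (P i) (A i)))
                  \<le> 4 * iota V E n / iota V E (n + 1) * real (card V)))))
     \<and> (\<forall>(G :: ('g, 'm) monoid_scheme) \<phi>.
          acts_by_automorphisms G V E \<phi> \<and> transitive_action G V \<phi>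
          \<and> \<not> (\<exists>P. system_of_imprimitivity G V \<phi> n P) \<longrightarrow>
          iota V E (n + 1) \<le> real (2 * (n + 1)) * iota V E n))"
proof -
  interpret simple_graph V E by fact
  have e: "card (edge_boundary V E (f ` X)) \<le> card (edge_boundary V E X)"
    if "f \<in> carrier (aut_group V E)" "X \<subseteq> V" for f X
    using surj_card_le[OF boundary_operator.finite_bd[OF edge_boundary_operator that(2)]
      edge_boundary_image[OF that]] .
  have v: "card (vertex_boundary V E (f ` X)) \<le> card (vertex_boundary V E X)"
    if "f \<in> carrier (aut_group V E)" "X \<subseteq> V" for f X
    using surj_card_le[OF boundary_operator.finite_bd[OF vertex_boundary_operator that(2)]
      vertex_boundary_image[OF that]] .
  show ?thesis
    unfolding achieves_h_def achieves_iota_def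
  proof (rule conjI, goal_cases)
    case 1
    show ?case
      by (rule aut_group_imprimitivity_achieving[OF edge_boundary_operator assms(2) _ h_def assms(3,4)])
        (rule e)
  next
    case 2
    show ?case
      by (rule aut_group_imprimitivity_achieving[OF vertex_boundary_operator assms(2) _ iota_def assms(3,4)])
        (rule v)
  qed
qed

end
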